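(* Let $d\ge 1$, let $M_d=M_d(\beta)$ be a real bivariate moment matrix, let $1\le n,m\le d$, let $p\in\mathcal P_{n-1}$, and let $q\in\mathcal P_m$ be a polynomial all of whose terms $x^uy^v$ satisfy $v<m$. Suppose $M_d$ is positive semidefinite and that its column dependence relations are generated entirely by $X^n=p(X,Y)$ and $Y^m=q(X,Y)$ via recursiveness and linearity. Then $M_d$ admits a unique $RG$ extension $$M_{d+1}=\begin{pmatrix} M_d & B(d+1)\\ B(d+1)^T & C(d+1)\end{pmatrix},$$ i.e., $\operatorname{Ran} B(d+1)\subseteq \operatorname{Ran} M_d$, the relations $$X^{n+f}Y^{d+1-n-f}=(x^fy^{d+1-n-f}p)(X,Y)\quad(0\le f\le d+1-n),$$ $$X^{d+1-m-g}Y^{m+g}=(x^{d+1-m-g}y^gq)(X,Y)\quad(0\le g\le d+1-m)$$ hold in the column space of $M_{d+1}$, and $M_{d+1}$ is recursively generated.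
   Context: $\mathcal P_k$ is the space of real polynomials in $x,y$ of total degree at most $k$; for $f\in\mathcal P_k$, $\hat f$ is its coefficient vector with respect to the monomials in degree-lexicographic order $1,x,y,x^2,xy,y^2,\ldots$. For a real sequence $\beta=\{\beta_{ij}\}_{i,j\ge0,\,i+j\le 2d}$, the moment matrix $M_d=M_d(\beta)$ has rows and columns indexed by the monomials of degree at most $d$ (denoted $1,X,Y,\ldots,X^d,\ldots,Y^d$), and the entry in row $X^iY^j$, column $X^kY^l$ is $\beta_{i+k,j+l}$. For $f=\sum a_{ij}x^iy^j\in\mathcal P_d$, $f(X,Y):=\sum a_{ij}X^iY^j=M_d\hat f$ (a combination of columns). $M_d$ is recursively generated if $f,g,fg\in\mathcal P_d$ and $f(X,Y)=0$ imply $(fg)(X,Y)=0$. "The column dependence relations of $M_d$ are generated entirely by $X^n=p(X,Y)$ and $Y^m=q(X,Y)$ via recursiveness and linearity" means that $\ker M_d$ is exactly the span of the vectors $\widehat{x^iy^j(x^n-p)}$ ($i,j\ge0$, $i+j+n\le d$) and $\widehat{x^ky^l(y^m-q)}$ ($k,l\ge0$, $k+l+m\le d$). A moment matrix extension $M_{d+1}$ of $M_d$ is a moment matrix $M_{d+1}(\beta^{(2d+2)})$ for some real sequence $\beta^{(2d+2)}$ of degree $2d+2$ extending $\beta$; in its block form, $B(d+1)$ has columns $X^{d+1},\ldots,Y^{d+1}$ and rows indexed by the monomials of degree at most $d$. $M_{d+1}$ is an $RG$ extension if $M_d$ is positive semidefinite, $\operatorname{Ran}B(d+1)\subseteq\operatorname{Ran}M_d$,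 each dependence relation in the column space of $M_d$ also holds among the corresponding columns of $M_{d+1}$, and $M_{d+1}$ is recursively generated. *)

theory Defs
  imports "HOL-Analysis.Analysis" "HOL-Analysis.Finite_Function_Topology"
begin

text \<open>
  The pair \<open>(i, j)\<close> stands for the monomial $x^i y^j$, and a real polynomial in $x, y$ is a
  finitely supported function from such pairs to the reals. Addition of pairs is componentwise,
  so the library product on this type is polynomial multiplication. A polynomial and its
  coefficient vector are the same object here. Matrices and vectors are indexed by the monomials
  themselves; enumerating these in degree-lexicographic order would only rename the indices.
\<close>

type_synonym monomial = "nat \<times> nat"
type_synonym bipoly = "monomial \<Rightarrow>\<^sub>0 real"
type_synonym bimatrix = "monomial \<Rightarrow> monomial \<Rightarrow> real"

definition monomials :: "nat \<Rightarrow> monomial set"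
  where "monomials k = {(i, j). i + j \<le> k}"

definition polys :: "nat \<Rightarrow> bipoly set"
  where "polys k = {f. Poly_Mapping.keys f \<subseteq> monomials k}"

definition xy :: "nat \<Rightarrow> nat \<Rightarrow> bipoly"
  where "xy i j = Poly_Mapping.single (i, j) 1"

text \<open>
  Matrices are padded by zeros outside their index sets, so that equality of functions is equality
  of matrices (and likewise for columns). Only the values \<open>\<beta> i j\<close> with \<open>i + j \<le> 2 * k\<close> enter.
\<close>

definition moment_matrix :: "nat \<Rightarrow> (nat \<Rightarrow> nat \<Rightarrow> real) \<Rightarrow> bimatrix"
  where "moment_matrix k \<beta> = (\<lambda>r c. if r \<in> monomials k \<and> c \<in> monomials k
           then \<beta> (fst r + fst c) (snd r + snd c) else 0)"

definition mat_vec :: "monomial set \<Rightarrow> bimatrix \<Rightarrow> (monomial \<Rightarrow> real) \<Rightarrow> monomial \<Rightarrow> real"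
  where "mat_vec C A v = (\<lambda>r. \<Sum>c\<in>C. A r c * v c)"

definition mat_range :: "monomial set \<Rightarrow> bimatrix \<Rightarrow> (monomial \<Rightarrow> real) set"
  where "mat_range C A = range (mat_vec C A)"

definition pos_semidef :: "nat \<Rightarrow> bimatrix \<Rightarrow> bool"
  where "pos_semidef k M \<longleftrightarrow>
    (\<forall>r\<in>monomials k. \<forall>c\<in>monomials k. M r c = M c r) \<and>
    (\<forall>v. 0 \<le> (\<Sum>r\<in>monomials k. v r * mat_vec (monomials k) M v r))"

text \<open>\<open>col_eval k M f\<close> is $f(X,Y)$, for \<open>f \<in> polys k\<close>.\<close>

definition col_eval :: "nat \<Rightarrow> bimatrix \<Rightarrow> bipoly \<Rightarrow> monomial \<Rightarrow> real"
  where "col_eval k M f = mat_vec (monomials k) M (Poly_Mapping.lookup f)"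

definition mat_kernel :: "nat \<Rightarrow> bimatrix \<Rightarrow> bipoly set"
  where "mat_kernel k M = {f \<in> polys k. col_eval k M f = (\<lambda>_. 0)}"

definition recursively_generated :: "nat \<Rightarrow> bimatrix \<Rightarrow> bool"
  where "recursively_generated k M \<longleftrightarrow>
    (\<forall>f g. f \<in> polys k \<longrightarrow> g \<in> polys k \<longrightarrow> f * g \<in> polys k \<longrightarrow>
       col_eval k M f = (\<lambda>_. 0) \<longrightarrow> col_eval k M (f * g) = (\<lambda>_. 0))"

definition relations_generated_by ::
    "nat \<Rightarrow> bimatrix \<Rightarrow> nat \<Rightarrow> bipoly \<Rightarrow> nat \<Rightarrow> bipoly \<Rightarrow> bool"
  where "relations_generated_by d M n p m q \<longleftrightarrow>
    mat_kernel d M =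
      span ({xy i j * (xy n 0 - p) | i j. i + j + n \<le> d} \<union>
            {xy k l * (xy 0 m - q) | k l. k + l + m \<le> d})"

definition moment_extension :: "nat \<Rightarrow> (nat \<Rightarrow> nat \<Rightarrow> real) \<Rightarrow> bimatrix \<Rightarrow> bool"
  where "moment_extension d \<beta> M \<longleftrightarrow>
    (\<exists>\<beta>'. (\<forall>i j. i + j \<le> 2 * d \<longrightarrow> \<beta>' i j = \<beta> i j) \<and> M = moment_matrix (d + 1) \<beta>')"

text \<open>The upper right block $B(d+1)$ of a matrix indexed by the monomials of degree at most
  \<open>d + 1\<close>; its columns are indexed by \<open>top_monomials d\<close>.\<close>

definition top_monomials :: "nat \<Rightarrow> monomial set"
  where "top_monomials d = monomials (d + 1) - monomials d"

definition B_block :: "nat \<Rightarrow> bimatrix \<Rightarrow> bimatrix"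
  where "B_block d M =
    (\<lambda>r c. if r \<in> monomials d \<and> c \<in> top_monomials d then M r c else 0)"

definition range_inclusion :: "nat \<Rightarrow> (nat \<Rightarrow> nat \<Rightarrow> real) \<Rightarrow> bimatrix \<Rightarrow> bool"
  where "range_inclusion d \<beta> M \<longleftrightarrow>
    mat_range (top_monomials d) (B_block d M) \<subseteq> mat_range (monomials d) (moment_matrix d \<beta>)"

definition RG_extension :: "nat \<Rightarrow> (nat \<Rightarrow> nat \<Rightarrow> real) \<Rightarrow> bimatrix \<Rightarrow> bool"
  where "RG_extension d \<beta> M \<longleftrightarrow>
    moment_extension d \<beta> M \<and>
    pos_semidef d (moment_matrix d \<beta>) \<and>
    range_inclusion d \<beta> M \<and>
    (\<forall>f\<in>polys d. col_eval d (moment_matrix d \<beta>) f = (\<lambda>_. 0) \<longrightarrow>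
       col_eval (d + 1) M f = (\<lambda>_. 0)) \<and>
    recursively_generated (d + 1) M"

end

theory Submission
  imports Defs
begin

text \<open>
  Let \<open>L\<close> be the functional on polynomials of degree \<open>\<le> 2d\<close> with moments \<open>\<beta>\<close>. Since
  \<open>x^n - p\<close> and \<open>y^m - q\<close> have the coprime leading monomials \<open>x^n\<close> and \<open>y^m\<close>, rewriting
  \<open>y^m\<close> to \<open>q\<close> and \<open>x^n\<close> to \<open>p\<close> decreases (total degree, degree in \<open>y\<close>) lexicographically, and
  there is a functional on all polynomials that vanishes on the ideal \<open>I\<close> generated by the two
  relations and agrees with \<open>L\<close> on the normal monomials \<open>x^i y^j\<close>, \<open>i < n\<close>, \<open>j < m\<close>. These have
  degree \<open>\<le> 2d - 2\<close>, so any functional that vanishes on the multiples of the relations of degree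
  \<open>\<le> 2d + 2\<close> is determined by \<open>L\<close>: this gives uniqueness, and also that the new functional
  extends \<open>L\<close>. Vanishing on \<open>I\<close> yields recursive generation, because a relation of \<open>M_{d+1}\<close>
  that has a nonconstant multiple of degree \<open>\<le> d + 1\<close> is already a relation of \<open>M_d\<close>. The range
  condition is the orthogonality of the columns of \<open>B(d+1)\<close> to the kernel of the symmetric
  matrix \<open>M_d\<close>.
\<close>

section \<open>Moment functionals and multiplication by monomials\<close>

text \<open>The Riesz functional of the moments. Summing over the finite support makes it total on
  polynomials, so a degree bound has to be stated only where two moment families are
  compared.\<close>

definition functional :: "(nat \<Rightarrow> nat \<Rightarrow> real) \<Rightarrow> bipoly \<Rightarrow> real"
  where "functional \<beta> f =
    (\<Sum>c\<in>Poly_Mapping.keys f. Poly_Mapping.lookup f c * \<beta> (fst c) (snd c))"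

lemma functional_superset:
  assumes "finite S" "Poly_Mapping.keys f \<subseteq> S"
  shows "functional \<beta> f = (\<Sum>c\<in>S. Poly_Mapping.lookup f c * \<beta> (fst c) (snd c))"
  unfolding functional_def
  by (rule sum.mono_neutral_left) (use assms in \<open>auto simp: in_keys_iff\<close>)

lemma lookup_scaleR:
  fixes f :: "'a \<Rightarrow>\<^sub>0 'b::real_vector"
  shows "Poly_Mapping.lookup (r *\<^sub>R f) c = r *\<^sub>R Poly_Mapping.lookup f c"
proof -
  have "finite {c. r *\<^sub>R Poly_Mapping.lookup f c \<noteq> 0}"
    by (rule finite_subset[OF _ finite_lookup[of f]]) auto
  then show ?thesis
    by (simp add: scaleR_poly_mapping_def)
qed

lemma linear_functional: "linear (functional \<beta>)"
proof (rule linearI)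
  fix f g :: bipoly and r :: real
  let ?S = "Poly_Mapping.keys f \<union> Poly_Mapping.keys g"
  have "Poly_Mapping.keys (f + g) \<subseteq> ?S"
    by (rule keys_add)
  then show "functional \<beta> (f + g) = functional \<beta> f + functional \<beta> g"
    by (simp add: functional_superset[of ?S] lookup_add distrib_right sum.distrib)
  have "Poly_Mapping.keys (r *\<^sub>R f) \<subseteq> Poly_Mapping.keys f"
    by (auto simp: in_keys_iff lookup_scaleR)
  then show "functional \<beta> (r *\<^sub>R f) = r *\<^sub>R functional \<beta> f"
    by (simp add: functional_superset[of "Poly_Mapping.keys f"] lookup_scaleR sum_distrib_left mult.assoc)
qed

lemmas functional_add = linear_add[OF linear_functional]
  and functional_diff = linear_diff[OF linear_functional]
  and functional_scaleR = linear_scale[OF linear_functional, simplified]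
  and functional_sum = linear_sum[OF linear_functional]
  and functional_0 [simp] = linear_0[OF linear_functional]

lemma functional_diff_left:
  "functional (\<lambda>i j. \<gamma> i j - \<delta> i j) f = functional \<gamma> f - functional \<delta> f"
  by (simp add: functional_def right_diff_distrib sum_subtractf)

lemma functional_xy [simp]: "functional \<beta> (xy i j) = \<beta> i j"
  by (simp add: functional_def xy_def)

lemma xy_0_0 [simp]: "xy 0 0 = 1"
  by (simp add: xy_def flip: single_one zero_prod_def)

lemma xy_mult_xy: "xy i j * xy k l = xy (i + k) (j + l)"
  by (simp add: xy_def mult_single)

lemma xy_mult_xy_mult: "xy i j * (xy k l * f) = xy (i + k) (j + l) * f"
  by (simp add: xy_mult_xy flip: mult.assoc)

lemma bipoly_eq_sum:
  "f = (\<Sum>c\<in>Poly_Mapping.keys f. Poly_Mapping.lookup f c *\<^sub>R xy (fst c) (snd c))"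
  by (rule poly_mapping_eqI)
    (auto simp: lookup_sum lookup_scaleR xy_def lookup_single when_def in_keys_iff
      sum.If_cases if_distrib cong: if_cong)

text \<open>Scaling by \<open>r\<close> is multiplication by the constant polynomial
  \<open>single 0 r\<close>, so the claim becomes associativity of the product.\<close>

lemma bipoly_scaleR_mult: "(r *\<^sub>R f) * g = r *\<^sub>R (f * g :: bipoly)"
proof -
  have scale: "r *\<^sub>R h = Poly_Mapping.single 0 r * h" for h :: bipoly
    by (rule poly_mapping_eqI)
      (simp add: lookup_scaleR flip: mult_map_scale_conv_mult, simp add: map.rep_eq when_def)
  show ?thesis
    by (simp add: scale mult.assoc)
qed

lemma bipoly_mult_scaleR: "f * (r *\<^sub>R g) = r *\<^sub>R (f * g :: bipoly)"
  by (simp add: mult.commute[of f] bipoly_scaleR_mult)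

text \<open>Expanding \<open>f\<close> into monomials reduces vanishing on all multiples of
  \<open>g\<close> to vanishing on its monomial multiples. This is how functionals are later shown
  to vanish on ideals.\<close>

lemma functional_mult:
  "functional \<beta> (f * g) =
    (\<Sum>c\<in>Poly_Mapping.keys f. Poly_Mapping.lookup f c * functional \<beta> (xy (fst c) (snd c) * g))"
proof -
  have "f * g = (\<Sum>c\<in>Poly_Mapping.keys f.
      Poly_Mapping.lookup f c *\<^sub>R (xy (fst c) (snd c) * g))"
    using arg_cong[OF bipoly_eq_sum[of f], of "\<lambda>h. h * g"]
    by (simp only: sum_distrib_right bipoly_scaleR_mult)
  then show ?thesis
    by (simp add: functional_sum functional_scaleR)
qed

lemma functional_xy_mult:
  "functional \<beta> (xy i j * f) =
    (\<Sum>c\<in>Poly_Mapping.keys f. Poly_Mapping.lookup f c * \<beta> (i + fst c) (j + snd c))"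
  unfolding mult.commute[of "xy i j" f] functional_mult[of \<beta> f]
  by (simp add: xy_mult_xy add.commute)

text \<open>With a coefficient read as the functional of an indicator family,
  \<open>functional_mult\<close> also computes the coefficients of a product.\<close>

lemma lookup_eq_functional:
  "Poly_Mapping.lookup f s = functional (\<lambda>i j. if (i, j) = s then 1 else 0) f"
proof -
  have "functional (\<lambda>i j. if (i, j) = s then 1 else 0) f =
      (\<Sum>c\<in>Poly_Mapping.keys f. if c = s then Poly_Mapping.lookup f c else 0)"
    unfolding functional_def by (rule sum.cong) auto
  then show ?thesis
    by (simp add: in_keys_iff)
qed

section \<open>Degree bounds and leading monomials\<close>

lemma finite_monomials [simp]: "finite (monomials k)"
  by (rule finite_subset[of _ "{..k} \<times> {..k}"]) (auto simp: monomials_def)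

lemma in_monomials_iff: "c \<in> monomials k \<longleftrightarrow> fst c + snd c \<le> k"
  by (cases c) (simp add: monomials_def)

lemma polysD: "f \<in> polys k \<Longrightarrow> c \<in> Poly_Mapping.keys f \<Longrightarrow> fst c + snd c \<le> k"
  by (auto simp: polys_def in_monomials_iff subset_iff)

lemma polys_mono: "k \<le> l \<Longrightarrow> polys k \<subseteq> polys l"
  by (fastforce simp: polys_def in_monomials_iff)

lemma polys_diff: "f \<in> polys k \<Longrightarrow> g \<in> polys k \<Longrightarrow> f - g \<in> polys k"
  unfolding polys_def using keys_diff[of f g] by blast

lemma subspace_polys: "subspace (polys k)"
  unfolding subspace_def polys_def in_keys_iff subset_iff
  by (auto simp: lookup_add lookup_scaleR) (metis add_0)

lemma xy_in_polys [simp]: "xy i j \<in> polys k \<longleftrightarrow> i + j \<le> k"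
  by (simp add: polys_def xy_def monomials_def)

lemma mult_in_polys: "f \<in> polys k \<Longrightarrow> g \<in> polys l \<Longrightarrow> f * g \<in> polys (k + l)"
  unfolding polys_def using keys_mult[of f g]
  by (fastforce simp: in_monomials_iff)

text \<open>Among the monomials of maximal total degree, one of maximal degree in x is chosen. Total
  degree and degree in x together determine a monomial, so every other one is strictly
  smaller.\<close>

lemma ex_leading_monomial:
  assumes "f \<noteq> (0 :: bipoly)"
  obtains a where "a \<in> Poly_Mapping.keys f"
    "\<And>c. c \<in> Poly_Mapping.keys f \<Longrightarrow> c = a \<or> fst c + snd c < fst a + snd a \<or>
      (fst c + snd c = fst a + snd a \<and> fst c < fst a)"
proof -
  let ?K = "Poly_Mapping.keys f"
  let ?D = "Max ((\<lambda>c. fst c + snd c) ` ?K)"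
  let ?T = "{c \<in> ?K. fst c + snd c = ?D}"
  have "?K \<noteq> {}"
    using assms by simp
  then have "?D \<in> (\<lambda>c. fst c + snd c) ` ?K"
    by (intro Max_in) auto
  then obtain e where "?D = fst e + snd e" "e \<in> ?K"
    by (rule imageE)
  then have "e \<in> ?T"
    by simp
  then have "?T \<noteq> {}"
    unfolding ex_in_conv[symmetric] by (rule exI)
  then have "Max (fst ` ?T) \<in> fst ` ?T"
    by (intro Max_in) simp_all
  then obtain a where a: "Max (fst ` ?T) = fst a" "a \<in> ?T"
    by (rule imageE)
  show thesis
  proof (rule that[of a])
    show "a \<in> ?K"
      using a by simp
    fix c assume c: "c \<in> ?K"
    then have le: "fst c + snd c \<le> ?D"
      by (intro Max_ge) auto
    show "c = a \<or> fst c + snd c < fst a + snd a \<or>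
        (fst c + snd c = fst a + snd a \<and> fst c < fst a)"
    proof (cases "fst c + snd c = ?D")
      case True
      then have "fst c \<le> fst a"
        unfolding a(1)[symmetric] using c True by (intro Max_ge) auto
      then show ?thesis
        using True a(2) by (auto simp: prod_eq_iff)
    next
      case False
      then show ?thesis
        using le a(2) by auto
    qed
  qed
qed

text \<open>The product of the leading monomials with respect to (total degree, degree in \<open>x\<close>) cannot
  cancel in \<open>f * g\<close>.\<close>

lemma mult_in_polys_Suc_left:
  assumes fg: "f * g \<in> polys (Suc k)" and g: "g \<notin> polys 0"
  shows "f \<in> polys k"
proof (cases "f = 0")
  case True
  then show ?thesis
    by (simp add: polys_def)
next
  case False
  have "g \<noteq> 0"
    using g by (auto simp: polys_def)
  obtain a where a: "a \<in> Poly_Mapping.keys f"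
    "\<And>c. c \<in> Poly_Mapping.keys f \<Longrightarrow> c = a \<or> fst c + snd c < fst a + snd a \<or>
      (fst c + snd c = fst a + snd a \<and> fst c < fst a)"
    using ex_leading_monomial[OF False] by blast
  obtain b where b: "b \<in> Poly_Mapping.keys g"
    "\<And>c. c \<in> Poly_Mapping.keys g \<Longrightarrow> c = b \<or> fst c + snd c < fst b + snd b \<or>
      (fst c + snd c = fst b + snd b \<and> fst c < fst b)"
    using ex_leading_monomial[OF \<open>g \<noteq> 0\<close>] by blast
  have eq: "c = a \<and> e = b"
    if "c \<in> Poly_Mapping.keys f" "e \<in> Poly_Mapping.keys g" "c + e = a + b" for c e
  proof -
    have "fst c + fst e = fst a + fst b" "snd c + snd e = snd a + snd b"
      using that(3) by (metis fst_add, metis snd_add)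
    with a(2)[OF that(1)] b(2)[OF that(2)] show ?thesis
      unfolding prod_eq_iff by linarith
  qed
  have "Poly_Mapping.lookup (f * g) (a + b) =
      (\<Sum>c\<in>Poly_Mapping.keys f. \<Sum>e\<in>Poly_Mapping.keys g.
        if c = a \<and> e = b then Poly_Mapping.lookup f c * Poly_Mapping.lookup g e else 0)"
    unfolding lookup_eq_functional[of "f * g"] functional_mult[of _ f] functional_xy_mult sum_distrib_left
  proof (intro sum.cong refl)
    fix c e assume ce: "c \<in> Poly_Mapping.keys f" "e \<in> Poly_Mapping.keys g"
    have "(fst c + fst e, snd c + snd e) = a + b \<longleftrightarrow> c = a \<and> e = b"
      using eq[OF ce] by (metis plus_prod_def)
    then show "Poly_Mapping.lookup f c * (Poly_Mapping.lookup g e *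
        (if (fst c + fst e, snd c + snd e) = a + b then 1 else 0)) =
        (if c = a \<and> e = b then Poly_Mapping.lookup f c * Poly_Mapping.lookup g e else 0)"
      by simp
  qed
  also have "\<dots> = (\<Sum>c\<in>Poly_Mapping.keys f. if c = a then
      (\<Sum>e\<in>Poly_Mapping.keys g. if e = b then Poly_Mapping.lookup f c * Poly_Mapping.lookup g e else 0)
      else 0)"
    by (intro sum.cong) auto
  also have "\<dots> = Poly_Mapping.lookup f a * Poly_Mapping.lookup g b"
    using a(1) b(1) by simp
  also have "\<dots> \<noteq> 0"
    using a(1) b(1) by (simp add: in_keys_iff)
  finally have "a + b \<in> Poly_Mapping.keys (f * g)"
    by (simp add: in_keys_iff)
  from polysD[OF fg this] have deg: "(fst a + snd a) + (fst b + snd b) \<le> Suc k"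
    by simp
  have deg_le: "fst c + snd c \<le> fst a + snd a" if "c \<in> Poly_Mapping.keys f" for c
    using a(2)[OF that] by (elim disjE) auto
  have deg_le': "fst c + snd c \<le> fst b + snd b" if "c \<in> Poly_Mapping.keys g" for c
    using b(2)[OF that] by (elim disjE) auto
  have "fst b + snd b \<noteq> 0"
  proof
    assume "fst b + snd b = 0"
    with deg_le' have "g \<in> polys 0"
      unfolding polys_def subset_iff in_monomials_iff by auto
    with g show False ..
  qed
  with deg have "fst a + snd a \<le> k"
    by linarith
  with deg_le show ?thesis
    unfolding polys_def subset_iff in_monomials_iff by (blast intro: le_trans)
qed

section \<open>Column relations of moment matrices in terms of functionals\<close>

lemma col_eval_moment_matrix:
  assumes "f \<in> polys k"
  shows "col_eval k (moment_matrix k \<beta>) f r =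
    (if r \<in> monomials k then functional \<beta> (xy (fst r) (snd r) * f) else 0)"
proof (cases "r \<in> monomials k")
  case True
  have "(\<Sum>c\<in>monomials k. \<beta> (fst r + fst c) (snd r + snd c) * Poly_Mapping.lookup f c) =
      (\<Sum>c\<in>Poly_Mapping.keys f. \<beta> (fst r + fst c) (snd r + snd c) * Poly_Mapping.lookup f c)"
    by (rule sum.mono_neutral_right) (use assms in \<open>auto simp: polys_def in_keys_iff\<close>)
  with True show ?thesis
    by (simp add: col_eval_def mat_vec_def moment_matrix_def functional_xy_mult mult.commute[of "\<beta> _ _"])
next
  case False
  then show ?thesis
    by (simp add: col_eval_def mat_vec_def moment_matrix_def)
qed

lemma col_eval_moment_matrix_eq_0_iff:
  assumes "f \<in> polys k"
  shows "col_eval k (moment_matrix k \<beta>) f = (\<lambda>_. 0) \<longleftrightarrow>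
    (\<forall>i j. i + j \<le> k \<longrightarrow> functional \<beta> (xy i j * f) = 0)"
  by (auto simp: fun_eq_iff col_eval_moment_matrix[OF assms] in_monomials_iff)

lemma col_eval_moment_matrix_eq_iff:
  assumes "f \<in> polys k" "g \<in> polys k"
  shows "col_eval k (moment_matrix k \<beta>) f = col_eval k (moment_matrix k \<beta>) g \<longleftrightarrow>
    col_eval k (moment_matrix k \<beta>) (f - g) = (\<lambda>_. 0)"
  unfolding col_eval_moment_matrix_eq_0_iff[OF polys_diff[OF assms]]
  by (auto simp: fun_eq_iff col_eval_moment_matrix assms in_monomials_iff right_diff_distrib
      functional_diff)

text \<open>A monomial of degree \<open>\<le> 2k - a\<close> is a product of one of degree \<open>\<le> k - a\<close> and one of
  degree \<open>\<le> k\<close>.\<close>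

lemma functional_relation_double_degree:
  assumes "a \<le> k"
    and rel: "\<And>i j. i + j + a \<le> k \<Longrightarrow>
      xy i j * f \<in> polys k \<and> col_eval k (moment_matrix k \<beta>) (xy i j * f) = (\<lambda>_. 0)"
    and "i + j + a \<le> 2 * k"
  shows "functional \<beta> (xy i j * f) = 0"
proof -
  \<comment> \<open>The exponents are filled greedily up to total degree \<open>k - a\<close>.
    Either the whole monomial is used up, or exactly \<open>k - a\<close> is split off and at most
    \<open>k\<close> remains.\<close>
  define i' where "i' = min i (k - a)"
  define j' where "j' = min j (k - a - i')"
  have le: "i' + j' + a \<le> k" "(i - i') + (j - j') \<le> k" "i' \<le> i" "j' \<le> j"
    using assms(1,3) by (auto simp: i'_def j'_def)
  have "functional \<beta> (xy (i - i') (j - j') * (xy i' j' * f)) = 0"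
    using rel[OF le(1)] le(2) by (auto simp: col_eval_moment_matrix_eq_0_iff)
  then show ?thesis
    using le by (simp add: xy_mult_xy_mult)
qed

lemma moment_matrix_cong:
  assumes "\<And>i j. i + j \<le> 2 * k \<Longrightarrow> \<beta> i j = \<gamma> i j"
  shows "moment_matrix k \<beta> = moment_matrix k \<gamma>"
  by (auto simp: moment_matrix_def fun_eq_iff in_monomials_iff intro!: assms)

lemma functional_cong:
  assumes "f \<in> polys k" "\<And>i j. i + j \<le> k \<Longrightarrow> \<beta> i j = \<gamma> i j"
  shows "functional \<beta> f = functional \<gamma> f"
  unfolding functional_def by (rule sum.cong) (use assms polysD in auto)

section \<open>Linear functionals vanishing on a common kernel\<close>

text \<open>This form of duality replaces orthogonal complements in the proof of the range
  condition. The induction removes one functional \<open>F b\<close>, after subtracting from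
  \<open>g\<close> the multiple of \<open>F b\<close> that it must contain.\<close>

lemma ex_linear_combination_of_common_kernel:
  fixes F :: "'i \<Rightarrow> 'v::real_vector \<Rightarrow> real"
  assumes "finite T" "subspace V" "\<And>c. c \<in> T \<Longrightarrow> linear (F c)" "linear g"
    and "\<And>v. v \<in> V \<Longrightarrow> \<forall>c\<in>T. F c v = 0 \<Longrightarrow> g v = 0"
  shows "\<exists>x. \<forall>v\<in>V. g v = (\<Sum>c\<in>T. F c v * x c)"
  using assms
proof (induction T arbitrary: g rule: finite_induct)
  case empty
  then show ?case by simp
next
  case (insert b T)
  have lin: "linear (F c)" if "c \<in> insert b T" for c
    using insert.prems(2) that .
  show ?case
  proof (cases "\<exists>v\<in>V. (\<forall>c\<in>T. F c v = 0) \<and> F b v \<noteq> 0")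
    case False
    \<comment> \<open>Here \<open>F b\<close> already vanishes on the common kernel of the others,
      so its coefficient can be taken to be 0.\<close>
    then have "\<exists>x. \<forall>v\<in>V. g v = (\<Sum>c\<in>T. F c v * x c)"
      using insert.prems by (intro insert.IH) auto
    then obtain x where x: "\<forall>v\<in>V. g v = (\<Sum>c\<in>T. F c v * x c)" ..
    have "(\<Sum>c\<in>T. F c v * (x(b := 0)) c) = (\<Sum>c\<in>T. F c v * x c)" for v
      by (rule sum.cong) (use insert.hyps in auto)
    with x insert.hyps show ?thesis
      by (intro exI[of _ "x(b := 0)"]) simp
  next
    case True
    then obtain v0 where v0: "v0 \<in> V" "\<forall>c\<in>T. F c v0 = 0" "F b v0 \<noteq> 0"
      by blast
    \<comment> \<open>All other functionals vanish at \<open>v0\<close>, so evaluation there forces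
      this coefficient of \<open>F b\<close>.\<close>
    define t where "t = g v0 / F b v0"
    have "\<exists>x. \<forall>v\<in>V. g v - t * F b v = (\<Sum>c\<in>T. F c v * x c)"
    proof (rule insert.IH)
      show "linear (\<lambda>v. g v - t * F b v)"
        using insert.prems(3) lin[of b]
        by (auto intro!: linearI simp: linear_add linear_scale algebra_simps)
      fix v assume v: "v \<in> V" "\<forall>c\<in>T. F c v = 0"
      \<comment> \<open>Projection of \<open>v\<close> along \<open>v0\<close> into the kernel of
        \<open>F b\<close>; the values of the other functionals stay 0.\<close>
      let ?w = "v - (F b v / F b v0) *\<^sub>R v0"
      have "?w \<in> V"
        using v(1) v0(1) insert.prems(1) by (simp add: subspace_diff subspace_scale)
      moreover have "\<forall>c\<in>insert b T. F c ?w = 0"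
        using v v0 lin by (auto simp: linear_diff linear_scale)
      ultimately have "g ?w = 0"
        by (rule insert.prems(4))
      then show "g v - t * F b v = 0"
        using insert.prems(3) by (simp add: linear_diff linear_scale t_def)
    qed (use insert.prems lin in auto)
    then obtain x where x: "\<forall>v\<in>V. g v - t * F b v = (\<Sum>c\<in>T. F c v * x c)" ..
    have "(\<Sum>c\<in>T. F c v * (x(b := t)) c) = (\<Sum>c\<in>T. F c v * x c)" for v
      by (rule sum.cong) (use insert.hyps in auto)
    with x insert.hyps show ?thesis
      by (intro exI[of _ "x(b := t)"]) (auto simp: algebra_simps)
  qed
qed

section \<open>Rewriting modulo the two relations\<close>

text \<open>Well-founded induction along the order that both rewriting rules decrease: total degree
  first, then the exponent of y.\<close>

lemma degree_snd_induct [case_names less]: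
  assumes "\<And>i j. (\<And>k l. k + l < i + j \<or> k + l = i + j \<and> l < j \<Longrightarrow> P k l) \<Longrightarrow> P i j"
  shows "P (i :: nat) (j :: nat)"
proof (induction "i + j" arbitrary: i j rule: less_induct)
  case less
  note outer = less
  have "k + l = i + j \<Longrightarrow> P k l" for k l
  proof (induction l arbitrary: k rule: less_induct)
    case (less l)
    show ?case
    proof (rule assms)
      fix k' l' assume "k' + l' < k + l \<or> k' + l' = k + l \<and> l' < l"
      then show "P k' l'"
        using outer[of k' l'] less by auto
    qed
  qed
  then show ?case by simp
qed

text \<open>The bounds differ because the exponent of y breaks ties: it can drop when y^m is
  replaced by terms of the same degree, but x^n has exponent 0 in y, so \<open>p\<close> must lower
  the total degree.\<close>

locale relation_pair =
  fixes n m :: nat and p q :: bipoly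
  assumes p_degree: "\<And>c. c \<in> Poly_Mapping.keys p \<Longrightarrow> fst c + snd c < n"
    and q_degree: "\<And>c. c \<in> Poly_Mapping.keys q \<Longrightarrow> fst c + snd c \<le> m \<and> snd c < m"
begin

lemma functional_x_relation:
  "functional \<gamma> (xy i j * (xy n 0 - p)) = \<gamma> (i + n) j -
    (\<Sum>c\<in>Poly_Mapping.keys p. Poly_Mapping.lookup p c * \<gamma> (i + fst c) (j + snd c))"
  by (simp add: right_diff_distrib functional_diff xy_mult_xy functional_xy_mult)

lemma functional_y_relation:
  "functional \<gamma> (xy i j * (xy 0 m - q)) = \<gamma> i (j + m) -
    (\<Sum>c\<in>Poly_Mapping.keys q. Poly_Mapping.lookup q c * \<gamma> (i + fst c) (j + snd c))"
  by (simp add: right_diff_distrib functional_diff xy_mult_xy functional_xy_mult)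

text \<open>A moment outside the normal range is expressed through smaller ones by a multiple of a
  relation of the same total degree, so the bound \<open>K\<close> is never exceeded. It is applied
  to differences of two moment families, which gives both extension and uniqueness.\<close>

lemma moments_determined:
  assumes x: "\<And>i j. i + j + n \<le> K \<Longrightarrow> functional \<gamma> (xy i j * (xy n 0 - p)) = 0"
    and y: "\<And>i j. i + j + m \<le> K \<Longrightarrow> functional \<gamma> (xy i j * (xy 0 m - q)) = 0"
    and normal: "\<And>i j. i < n \<Longrightarrow> j < m \<Longrightarrow> \<gamma> i j = 0"
  shows "i + j \<le> K \<Longrightarrow> \<gamma> i j = 0"
proof (induction i j rule: degree_snd_induct)
  case (less i j)
  consider "i < n" "j < m" | "n \<le> i" | "m \<le> j"
    by linarith
  then show ?case
  proof cases
    case 1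
    then show ?thesis by (rule normal)
  next
    case 2
    have "\<gamma> (i - n + fst c) (j + snd c) = 0" if "c \<in> Poly_Mapping.keys p" for c
      using p_degree[OF that] 2 less.prems by (intro less.IH) auto
    moreover have "functional \<gamma> (xy (i - n) j * (xy n 0 - p)) = 0"
      using 2 less.prems by (intro x) auto
    ultimately show ?thesis
      using 2 by (simp add: functional_x_relation)
  next
    case 3
    have "\<gamma> (i + fst c) (j - m + snd c) = 0" if "c \<in> Poly_Mapping.keys q" for c
      using q_degree[OF that] 3 less.prems by (intro less.IH) auto
    moreover have "functional \<gamma> (xy i (j - m) * (xy 0 m - q)) = 0"
      using 3 less.prems by (intro y) auto
    ultimately show ?thesis
      using 3 by (simp add: functional_y_relation)
  qed
qed

text \<open>Reduction to normal form, transported to moments. Trying the y rule first fixes a choice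
  where both rules apply; the y relation then holds by unfolding, and consistency has to be proved
  only for the x relation.\<close>

function ideal_extension :: "(nat \<Rightarrow> nat \<Rightarrow> real) \<Rightarrow> nat \<Rightarrow> nat \<Rightarrow> real" where
  "ideal_extension \<beta> i j =
    (if m \<le> j then
      (\<Sum>c\<in>Poly_Mapping.keys q. Poly_Mapping.lookup q c * ideal_extension \<beta> (i + fst c) (j - m + snd c))
    else if n \<le> i then
      (\<Sum>c\<in>Poly_Mapping.keys p. Poly_Mapping.lookup p c * ideal_extension \<beta> (i - n + fst c) (j + snd c))
    else \<beta> i j)"
  by pat_completeness auto
termination
proof (relation "measures [\<lambda>(\<beta>, i, j). i + j, \<lambda>(\<beta>, i, j). j]", goal_cases)
  case 1
  show ?case by simp
next
  case (2 \<beta> i j c)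
  then show ?case
    using q_degree[of c] by auto
next
  case (3 \<beta> i j c)
  then show ?case
    using p_degree[of c] by auto
qed

declare ideal_extension.simps [simp del]

lemma ideal_extension_y:
  "functional (ideal_extension \<beta>) (h * (xy 0 m - q)) = 0"
proof -
  have "functional (ideal_extension \<beta>) (xy i j * (xy 0 m - q)) = 0" for i j
    by (simp add: functional_y_relation ideal_extension.simps[of \<beta> i "j + m"])
  then show ?thesis
    by (simp add: functional_mult[of _ h])
qed

text \<open>For \<open>j < m\<close> the x rule itself applies. Otherwise a factor y^m of the
  multiplier is replaced by \<open>q\<close>: the difference is a multiple of the y relation, and
  what remains involves only smaller multipliers of the x relation. This is Buchberger's coprimality
  criterion in functional form.\<close>

lemma ideal_extension_x:
  "functional (ideal_extension \<beta>) (h * (xy n 0 - p)) = 0"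
proof -
  have "functional (ideal_extension \<beta>) (xy i j * (xy n 0 - p)) = 0" for i j
  proof (induction i j rule: degree_snd_induct)
    case (less i j)
    show ?case
    proof (cases "m \<le> j")
      case False
      then show ?thesis
        by (simp add: functional_x_relation ideal_extension.simps[of \<beta> "i + n" j])
    next
      case True
      let ?u = "xy n 0 - p"
      have "xy i j = xy i (j - m) * xy 0 m"
        using True by (simp add: xy_mult_xy)
      then have "xy i j * ?u = (xy i (j - m) * ?u) * (xy 0 m - q) + q * (xy i (j - m) * ?u)"
        by (simp add: algebra_simps)
      then have "functional (ideal_extension \<beta>) (xy i j * ?u) =
          functional (ideal_extension \<beta>) (q * (xy i (j - m) * ?u))"
        by (simp add: functional_add ideal_extension_y)
      also have "\<dots> = (\<Sum>c\<in>Poly_Mapping.keys q. Poly_Mapping.lookup q c *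
          functional (ideal_extension \<beta>) (xy (fst c + i) (snd c + (j - m)) * ?u))"
        unfolding functional_mult[of _ q] xy_mult_xy_mult ..
      also have "\<dots> = 0"
      proof (rule sum.neutral, rule ballI)
        fix c assume c: "c \<in> Poly_Mapping.keys q"
        have "functional (ideal_extension \<beta>) (xy (fst c + i) (snd c + (j - m)) * ?u) = 0"
          using q_degree[OF c] True by (intro less.IH) auto
        then show "Poly_Mapping.lookup q c *
            functional (ideal_extension \<beta>) (xy (fst c + i) (snd c + (j - m)) * ?u) = 0"
          by simp
      qed
      finally show ?thesis .
    qed
  qed
  then show ?thesis
    by (simp add: functional_mult[of _ h])
qed

text \<open>The factor \<open>h\<close> has arbitrary degree, so a kernel element, which lies in a
  span of bounded degree, has all its multiples annihilated.\<close>

lemma ideal_extension_span: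
  assumes "f \<in> span ({xy i j * (xy n 0 - p) | i j. A i j} \<union> {xy k l * (xy 0 m - q) | k l. B k l})"
  shows "functional (ideal_extension \<beta>) (h * f) = 0"
  using assms
proof (induction arbitrary: h rule: span_induct_alt)
  case base
  then show ?case by simp
next
  case (step r f g)
  have "functional (ideal_extension \<beta>) (h * f) = 0"
    using step.hyps by (auto simp: ideal_extension_x ideal_extension_y simp flip: mult.assoc)
  then show ?case
    using step.IH by (simp add: distrib_left bipoly_mult_scaleR functional_add functional_scaleR)
qed

end

section \<open>Range inclusion and the kernel of the smaller matrix\<close>

text \<open>In a row of degree at most \<open>d\<close> only the old moments occur. A row of degree
  \<open>d + 1\<close> is the transpose of a column of the B block, which equals M_d v for some v;
  by symmetry of M_d its pairing with \<open>f\<close> is that of v with M_d f, which is 0.\<close>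

lemma col_eval_0_of_range_inclusion:
  assumes M: "M = moment_matrix (d + 1) \<gamma>" and agree: "\<And>i j. i + j \<le> 2 * d \<Longrightarrow> \<gamma> i j = \<beta> i j"
    and incl: "range_inclusion d \<beta> M"
    and f: "f \<in> polys d" and ker: "col_eval d (moment_matrix d \<beta>) f = (\<lambda>_. 0)"
  shows "col_eval (d + 1) M f = (\<lambda>_. 0)"
proof -
  have f': "f \<in> polys (d + 1)"
    using f polys_mono[of d "d + 1"] by auto
  have "functional \<gamma> (xy i j * f) = 0" if ij: "i + j \<le> d + 1" for i j
  proof (cases "i + j \<le> d")
    case True
    have "xy i j * f \<in> polys (2 * d)"
      using mult_in_polys[of "xy i j" "i + j" f d] f True polys_mono[of "i + j + d" "2 * d"] by auto
    then have "functional \<gamma> (xy i j * f) = functional \<beta> (xy i j * f)"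
      by (rule functional_cong) (rule agree)
    then show ?thesis
      using ker f True by (simp add: col_eval_moment_matrix_eq_0_iff)
  next
    case False
    then have top: "(i, j) \<in> top_monomials d"
      using ij by (simp add: top_monomials_def in_monomials_iff)
    \<comment> \<open>The unit vector that selects the column \<open>(i, j)\<close> of the B
      block.\<close>
    let ?e = "\<lambda>c. if c = (i, j) then 1 else 0 :: real"
    have "mat_vec (top_monomials d) (B_block d M) ?e \<in> mat_range (monomials d) (moment_matrix d \<beta>)"
      using incl by (auto simp: range_inclusion_def mat_range_def)
    then obtain v where v: "mat_vec (top_monomials d) (B_block d M) ?e =
        mat_vec (monomials d) (moment_matrix d \<beta>) v"
      by (auto simp: mat_range_def)
    have fin: "finite (top_monomials d)"
      by (simp add: top_monomials_def)
    have col: "\<gamma> (i + fst r) (j + snd r) =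
        (\<Sum>c\<in>monomials d. \<beta> (fst r + fst c) (snd r + snd c) * v c)" if r: "r \<in> monomials d" for r
    proof -
      have "mat_vec (top_monomials d) (B_block d M) ?e r = B_block d M r (i, j)"
        using top fin by (simp add: mat_vec_def if_distrib cong: if_cong)
      also have "\<dots> = \<gamma> (i + fst r) (j + snd r)"
        using r top ij by (simp add: B_block_def M moment_matrix_def in_monomials_iff add.commute)
      finally have "mat_vec (monomials d) (moment_matrix d \<beta>) v r = \<gamma> (i + fst r) (j + snd r)"
        by (simp only: v)
      with r show ?thesis
        by (simp add: mat_vec_def moment_matrix_def)
    qed
    have "functional \<gamma> (xy i j * f) =
        (\<Sum>r\<in>Poly_Mapping.keys f. \<Sum>c\<in>monomials d.
          Poly_Mapping.lookup f r * (\<beta> (fst r + fst c) (snd r + snd c) * v c))"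
      unfolding functional_xy_mult sum_distrib_left[symmetric]
      by (rule sum.cong) (use f col in \<open>auto simp: polys_def subset_iff\<close>)
    also have "\<dots> = (\<Sum>c\<in>monomials d. \<Sum>r\<in>Poly_Mapping.keys f.
          Poly_Mapping.lookup f r * (\<beta> (fst r + fst c) (snd r + snd c) * v c))"
      by (rule sum.swap)
    also have "\<dots> = (\<Sum>c\<in>monomials d. functional \<beta> (xy (fst c) (snd c) * f) * v c)"
      by (simp add: functional_xy_mult sum_distrib_right mult.assoc add.commute)
    also have "\<dots> = 0"
      using ker f by (intro sum.neutral) (simp add: col_eval_moment_matrix_eq_0_iff in_monomials_iff)
    finally show ?thesis .
  qed
  then show ?thesis
    using f' by (simp add: M col_eval_moment_matrix_eq_0_iff)
qed

text \<open>Rows of M_d and combinations of columns of the B block both act as functionals on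
  \<open>polys d\<close>. By hypothesis the latter vanish on the common kernel of the former, hence
  are combinations of them; symmetry turns these rows into columns.\<close>

lemma range_inclusion_of_kernel:
  assumes M: "M = moment_matrix (d + 1) \<gamma>"
    and ker: "\<And>f. f \<in> polys d \<Longrightarrow> col_eval d (moment_matrix d \<beta>) f = (\<lambda>_. 0) \<Longrightarrow>
      col_eval (d + 1) M f = (\<lambda>_. 0)"
  shows "range_inclusion d \<beta> M"
  unfolding range_inclusion_def mat_range_def
proof (intro subsetI, elim rangeE)
  fix w v assume w: "w = mat_vec (top_monomials d) (B_block d M) v"
  \<comment> \<open>The pairing of \<open>w\<close> with the coefficient vector of \<open>f\<close>;
    testing it on the monomials recovers the entries of \<open>w\<close>.\<close>
  let ?h = "\<lambda>f. \<Sum>c\<in>top_monomials d. functional \<gamma> (xy (fst c) (snd c) * f) * v c"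
  have lin: "linear (\<lambda>f. functional \<gamma> (xy i j * f))" for i j \<gamma>
    by (rule linearI)
      (simp_all add: distrib_left bipoly_mult_scaleR functional_add functional_scaleR)
  have "\<exists>x. \<forall>f\<in>polys d. ?h f = (\<Sum>c\<in>monomials d. functional \<beta> (xy (fst c) (snd c) * f) * x c)"
  proof (rule ex_linear_combination_of_common_kernel[OF finite_monomials subspace_polys lin])
    show "linear ?h"
      by (rule linearI)
        (simp_all add: distrib_left bipoly_mult_scaleR functional_add functional_scaleR
          sum.distrib distrib_right sum_distrib_left mult.assoc)
    fix f assume f: "f \<in> polys d"
      and "\<forall>c\<in>monomials d. functional \<beta> (xy (fst c) (snd c) * f) = 0"
    then have "col_eval d (moment_matrix d \<beta>) f = (\<lambda>_. 0)"
      by (simp add: col_eval_moment_matrix fun_eq_iff del: split_paired_All)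
    with f have *: "col_eval (d + 1) M f = (\<lambda>_. 0)"
      by (rule ker)
    have "f \<in> polys (d + 1)"
      using f polys_mono[of d "d + 1"] by auto
    with * show "?h f = 0"
      by (intro sum.neutral)
        (auto simp: M col_eval_moment_matrix_eq_0_iff top_monomials_def in_monomials_iff)
  qed
  then obtain x where x: "\<forall>f\<in>polys d. ?h f =
      (\<Sum>c\<in>monomials d. functional \<beta> (xy (fst c) (snd c) * f) * x c)" ..
  have "w r = mat_vec (monomials d) (moment_matrix d \<beta>) x r" for r
  proof (cases "r \<in> monomials d")
    case False
    then show ?thesis
      by (simp add: w mat_vec_def B_block_def moment_matrix_def)
  next
    case True
    then have "xy (fst r) (snd r) \<in> polys d"
      by (simp add: in_monomials_iff)
    with x have "?h (xy (fst r) (snd r)) =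
        (\<Sum>c\<in>monomials d. functional \<beta> (xy (fst c) (snd c) * xy (fst r) (snd r)) * x c)" ..
    moreover have "B_block d M r c = \<gamma> (fst r + fst c) (snd r + snd c)" if "c \<in> top_monomials d" for c
      using that True by (auto simp: B_block_def M moment_matrix_def top_monomials_def in_monomials_iff)
    ultimately show ?thesis
      using True by (simp add: w mat_vec_def moment_matrix_def xy_mult_xy add.commute)
  qed
  then have "w = mat_vec (monomials d) (moment_matrix d \<beta>) x" ..
  then show "w \<in> range (mat_vec (monomials d) (moment_matrix d \<beta>))"
    by simp
qed

section \<open>Existence, uniqueness and characterization of the extension\<close>

theorem theorem2p3:
  fixes d n m :: nat and \<beta> :: "nat \<Rightarrow> nat \<Rightarrow> real" and p q :: bipoly
  assumes "1 \<le> d"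
    and "1 \<le> n" and "n \<le> d"
    and "1 \<le> m" and "m \<le> d"
    and "p \<in> polys (n - 1)"
    and "q \<in> polys m"
    and "\<forall>(u, v) \<in> Poly_Mapping.keys q. v < m"
    and "pos_semidef d (moment_matrix d \<beta>)"
    and "relations_generated_by d (moment_matrix d \<beta>) n p m q"
  shows "(\<exists>!M. RG_extension d \<beta> M) \<and>
    (\<forall>M. moment_extension d \<beta> M \<longrightarrow>
      (RG_extension d \<beta> M \<longleftrightarrow>
        range_inclusion d \<beta> M \<and>
        (\<forall>f \<le> d + 1 - n.
          col_eval (d + 1) M (xy (n + f) (d + 1 - n - f)) =
          col_eval (d + 1) M (xy f (d + 1 - n - f) * p)) \<and>
        (\<forall>g \<le> d + 1 - m.
          col_eval (d + 1) M (xy (d + 1 - m - g) (m + g)) =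
          col_eval (d + 1) M (xy (d + 1 - m - g) g * q)) \<and>
        recursively_generated (d + 1) M))"
proof -
  let ?u = "xy n 0 - p" and ?w = "xy 0 m - q" and ?M = "moment_matrix d \<beta>"
  interpret relation_pair n m p q
  proof
    fix c
    show "fst c + snd c < n" if "c \<in> Poly_Mapping.keys p"
      using polysD[OF assms(6) that] assms(2) by simp
    show "fst c + snd c \<le> m \<and> snd c < m" if "c \<in> Poly_Mapping.keys q"
      using polysD[OF assms(7) that] assms(8) that by (cases c) auto
  qed
  have kernel: "mat_kernel d ?M =
      span ({xy i j * ?u | i j. i + j + n \<le> d} \<union> {xy k l * ?w | k l. k + l + m \<le> d})"
    using assms(10) by (simp add: relations_generated_by_def)
  have u: "?u \<in> polys n" and w: "?w \<in> polys m"
    using assms(2,6,7) polys_mono[of "n - 1" n] by (auto intro!: polys_diff)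
  have xy_u: "xy i j * ?u \<in> polys k" if "i + j + n \<le> k" for i j k
    using mult_in_polys[of "xy i j" "i + j", OF _ u] polys_mono[OF that] by auto
  have xy_w: "xy i j * ?w \<in> polys k" if "i + j + m \<le> k" for i j k
    using mult_in_polys[of "xy i j" "i + j", OF _ w] polys_mono[OF that] by auto
  have ker_u: "col_eval d ?M (xy i j * ?u) = (\<lambda>_. 0)" if "i + j + n \<le> d" for i j
  proof -
    have "xy i j * ?u \<in> mat_kernel d ?M"
      unfolding kernel using that by (intro span_base) blast
    then show ?thesis by (simp add: mat_kernel_def)
  qed
  have ker_w: "col_eval d ?M (xy i j * ?w) = (\<lambda>_. 0)" if "i + j + m \<le> d" for i j
  proof -
    have "xy i j * ?w \<in> mat_kernel d ?M"
      unfolding kernel using that by (intro span_base) blast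
    then show ?thesis by (simp add: mat_kernel_def)
  qed
  have beta_u: "functional \<beta> (xy i j * ?u) = 0" if "i + j + n \<le> 2 * d" for i j
    by (rule functional_relation_double_degree[OF assms(3) _ that]) (simp add: xy_u ker_u)
  have beta_w: "functional \<beta> (xy i j * ?w) = 0" if "i + j + m \<le> 2 * d" for i j
    by (rule functional_relation_double_degree[OF assms(5) _ that]) (simp add: xy_w ker_w)

  have RG_mult: "col_eval (d + 1) M (xy i j * f) = (\<lambda>_. 0)"
    if "RG_extension d \<beta> M" "f \<in> polys d" "col_eval d ?M f = (\<lambda>_. 0)"
      "i + j \<le> d + 1" "xy i j * f \<in> polys (d + 1)" for M i j f
  proof -
    have "f \<in> polys (d + 1)"
      using that(2) polys_mono[of d "d + 1"] by auto
    then show ?thesis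
      using that unfolding RG_extension_def recursively_generated_def
      by (simp add: mult.commute[of "xy i j"])
  qed
  \<comment> \<open>Multiples of degree \<open>d + 1\<close> are not covered by M_d. They come from
    the relation itself, which fits into M_d because \<open>n \<le> d\<close>, by recursive
    generation of \<open>M\<close>.\<close>
  have top_u: "col_eval (d + 1) M (xy i j * ?u) = (\<lambda>_. 0)"
    if "RG_extension d \<beta> M" "i + j + n \<le> d + 1" for M i j
    using that xy_u[of 0 0 d] ker_u[of 0 0] assms(3) by (intro RG_mult xy_u) simp_all
  have top_w: "col_eval (d + 1) M (xy i j * ?w) = (\<lambda>_. 0)"
    if "RG_extension d \<beta> M" "i + j + m \<le> d + 1" for M i j
    using that xy_w[of 0 0 d] ker_w[of 0 0] assms(5) by (intro RG_mult xy_w) simp_all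

  define \<gamma> where "\<gamma> = ideal_extension \<beta>"
  have gamma_normal: "\<gamma> i j = \<beta> i j" if "i < n" "j < m" for i j
    using that by (simp add: \<gamma>_def ideal_extension.simps)
  have gamma_agree: "\<gamma> i j = \<beta> i j" if "i + j \<le> 2 * d" for i j
  proof -
    \<comment> \<open>Both families satisfy the relations up to degree \<open>2 * d\<close> and
      coincide on normal monomials.\<close>
    have "\<gamma> i j - \<beta> i j = 0"
      by (rule moments_determined[of "2 * d" "\<lambda>i j. \<gamma> i j - \<beta> i j", OF _ _ _ that])
        (simp_all add: functional_diff_left beta_u beta_w gamma_normal,
          simp_all add: \<gamma>_def ideal_extension_x ideal_extension_y)
    then show ?thesis by simp
  qed
  have gamma_kernel: "functional \<gamma> (h * f) = 0"
    if "f \<in> polys d" "col_eval d ?M f = (\<lambda>_. 0)" for f h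
    unfolding \<gamma>_def by (rule ideal_extension_span) (use that kernel in \<open>auto simp: mat_kernel_def\<close>)

  let ?N = "moment_matrix (d + 1) \<gamma>"
  have N_kernel: "col_eval (d + 1) ?N f = (\<lambda>_. 0)"
    if "f \<in> polys d" "col_eval d ?M f = (\<lambda>_. 0)" for f
    using that polys_mono[of d "d + 1"] gamma_kernel[OF that]
    by (subst col_eval_moment_matrix_eq_0_iff) auto
  have N: "RG_extension d \<beta> ?N"
    unfolding RG_extension_def
  proof (intro conjI ballI impI)
    show "moment_extension d \<beta> ?N"
      unfolding moment_extension_def using gamma_agree by blast
    show "range_inclusion d \<beta> ?N"
      by (rule range_inclusion_of_kernel[OF refl N_kernel])
    show "recursively_generated (d + 1) ?N"
      unfolding recursively_generated_def
    proof (intro allI impI)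
      fix f g
      assume f: "f \<in> polys (d + 1)" and fg: "f * g \<in> polys (d + 1)"
        and f0: "col_eval (d + 1) ?N f = (\<lambda>_. 0)"
      have f0': "functional \<gamma> (xy i j * f) = 0" if "i + j \<le> d + 1" for i j
        using f0 f that by (simp add: col_eval_moment_matrix_eq_0_iff)
      show "col_eval (d + 1) ?N (f * g) = (\<lambda>_. 0)"
        unfolding col_eval_moment_matrix_eq_0_iff[OF fg]
      proof (intro allI impI)
        fix i j assume ij: "i + j \<le> d + 1"
        show "functional \<gamma> (xy i j * (f * g)) = 0"
        \<comment> \<open>A constant \<open>g\<close> only rescales \<open>f\<close>, which may then
          have degree \<open>d + 1\<close>. A nonconstant \<open>g\<close> forces \<open>f\<close>
          into \<open>polys d\<close>, so \<open>f\<close> is a relation of M_d and \<gamma>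
          annihilates all its multiples.\<close>
        proof (cases "g \<in> polys 0")
          case True
          have "functional \<gamma> (g * (xy i j * f)) = 0"
            unfolding functional_mult[of _ g]
            by (rule sum.neutral) (use polysD[OF True] ij in \<open>auto simp: xy_mult_xy_mult f0'\<close>)
          then show ?thesis
            by (simp add: ac_simps)
        next
          case False
          then have fd: "f \<in> polys d"
            using fg mult_in_polys_Suc_left[of f g d] by simp
          have "functional \<beta> (xy k l * f) = 0" if "k + l \<le> d" for k l
          proof -
            have "xy k l * f \<in> polys (2 * d)"
              using mult_in_polys[of "xy k l" "k + l", OF _ fd] that polys_mono[of "k + l + d" "2 * d"]
              by auto
            then have "functional \<beta> (xy k l * f) = functional \<gamma> (xy k l * f)"
              by (rule functional_cong) (simp add: gamma_agree)
            with that show ?thesis by (simp add: f0')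
          qed
          then have "col_eval d ?M f = (\<lambda>_. 0)"
            using fd by (simp add: col_eval_moment_matrix_eq_0_iff)
          from gamma_kernel[OF fd this, of "xy i j * g"] show ?thesis
            by (simp add: ac_simps)
        qed
      qed
    qed
  qed (use assms(9) N_kernel in auto)

  have unique: "M = ?N" if M: "RG_extension d \<beta> M" for M
  proof -
    obtain \<delta> where agree: "\<And>i j. i + j \<le> 2 * d \<Longrightarrow> \<delta> i j = \<beta> i j"
      and M_eq: "M = moment_matrix (d + 1) \<delta>"
      using M by (auto simp: RG_extension_def moment_extension_def)
    have delta_u: "functional \<delta> (xy i j * ?u) = 0" if "i + j + n \<le> 2 * (d + 1)" for i j
      by (rule functional_relation_double_degree[OF _ _ that])
        (use assms(3) xy_u top_u[OF M] M_eq in auto)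
    have delta_w: "functional \<delta> (xy i j * ?w) = 0" if "i + j + m \<le> 2 * (d + 1)" for i j
      by (rule functional_relation_double_degree[OF _ _ that])
        (use assms(5) xy_w top_w[OF M] M_eq in auto)
    have "\<delta> i j = \<gamma> i j" if "i + j \<le> 2 * (d + 1)" for i j
    proof -
      have "\<delta> i j - \<gamma> i j = 0"
      proof (rule moments_determined[of "2 * (d + 1)" "\<lambda>i j. \<delta> i j - \<gamma> i j", OF _ _ _ that])
        fix i j
        \<comment> \<open>Normal monomials have degree at most \<open>n + m - 2\<close>, hence at
          most \<open>2 * d - 2\<close>, where the moments are prescribed by \<beta>.\<close>
        show "\<delta> i j - \<gamma> i j = 0" if "i < n" "j < m"
          using that agree[of i j] gamma_normal[of i j] assms(3,5) by simp
      qed (simp_all only: functional_diff_left delta_u delta_w \<gamma>_def ideal_extension_x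
          ideal_extension_y diff_self)
      then show ?thesis by simp
    qed
    then show ?thesis
      unfolding M_eq by (rule moment_matrix_cong)
  qed

  have equiv: "RG_extension d \<beta> M \<longleftrightarrow>
        range_inclusion d \<beta> M \<and>
        (\<forall>f \<le> d + 1 - n.
          col_eval (d + 1) M (xy (n + f) (d + 1 - n - f)) =
          col_eval (d + 1) M (xy f (d + 1 - n - f) * p)) \<and>
        (\<forall>g \<le> d + 1 - m.
          col_eval (d + 1) M (xy (d + 1 - m - g) (m + g)) =
          col_eval (d + 1) M (xy (d + 1 - m - g) g * q)) \<and>
        recursively_generated (d + 1) M" (is "_ \<longleftrightarrow> ?R")
    if ext: "moment_extension d \<beta> M" for M
  proof -
    obtain \<delta> where agree: "\<And>i j. i + j \<le> 2 * d \<Longrightarrow> \<delta> i j = \<beta> i j"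
      and M_eq: "M = moment_matrix (d + 1) \<delta>"
      using ext by (auto simp: moment_extension_def)
    show ?thesis
    proof
      assume M: "RG_extension d \<beta> M"
      have "col_eval (d + 1) M (xy (n + f) (d + 1 - n - f)) =
          col_eval (d + 1) M (xy f (d + 1 - n - f) * p)" if f: "f \<le> d + 1 - n" for f
      proof -
        \<comment> \<open>The bound on \<open>f\<close> makes the truncated subtractions exact, so
          the difference of the two columns is a multiple of the relation of degree bound exactly
          \<open>d + 1\<close>.\<close>
        have deg: "f + (d + 1 - n - f) + n = d + 1"
          using f assms(3) by simp
        have "xy f (d + 1 - n - f) * p \<in> polys (f + (d + 1 - n - f) + (n - 1))"
          using assms(6) by (intro mult_in_polys) auto
        moreover have "f + (d + 1 - n - f) + (n - 1) \<le> d + 1"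
          using deg by linarith
        ultimately have "xy f (d + 1 - n - f) * p \<in> polys (d + 1)"
          using polys_mono by blast
        moreover have "xy (n + f) (d + 1 - n - f) \<in> polys (d + 1)"
          using deg by simp
        moreover have "xy (n + f) (d + 1 - n - f) - xy f (d + 1 - n - f) * p =
            xy f (d + 1 - n - f) * ?u"
          by (simp add: right_diff_distrib xy_mult_xy add.commute)
        ultimately show ?thesis
          using top_u[OF M, of f "d + 1 - n - f"] deg
          unfolding M_eq by (simp add: col_eval_moment_matrix_eq_iff)
      qed
      moreover have "col_eval (d + 1) M (xy (d + 1 - m - g) (m + g)) =
          col_eval (d + 1) M (xy (d + 1 - m - g) g * q)" if g: "g \<le> d + 1 - m" for g
      proof -
        have deg: "(d + 1 - m - g) + g + m = d + 1"
          using g assms(5) by simp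
        have "xy (d + 1 - m - g) g * q \<in> polys ((d + 1 - m - g) + g + m)"
          using assms(7) by (intro mult_in_polys) auto
        then have "xy (d + 1 - m - g) g * q \<in> polys (d + 1)"
          using deg by simp
        moreover have "xy (d + 1 - m - g) (m + g) \<in> polys (d + 1)"
          using deg by simp
        moreover have "xy (d + 1 - m - g) (m + g) - xy (d + 1 - m - g) g * q =
            xy (d + 1 - m - g) g * ?w"
          by (simp add: right_diff_distrib xy_mult_xy add.commute)
        ultimately show ?thesis
          using top_w[OF M, of "d + 1 - m - g" g] deg
          unfolding M_eq by (simp add: col_eval_moment_matrix_eq_iff)
      qed
      ultimately show ?R
        using M by (auto simp: RG_extension_def)
    next
      \<comment> \<open>Range inclusion carries the dependence relations of M_d over to
        \<open>M\<close>.\<close>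
      assume ?R
      then show "RG_extension d \<beta> M"
        unfolding RG_extension_def
        using ext assms(9) col_eval_0_of_range_inclusion[OF M_eq agree] by blast
    qed
  qed
  show ?thesis
    using N unique equiv by blast
qed

end
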